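(* For any $n\ge1$, if a nonempty subset $A\subset\mathbb{S}^n$ satisfies $D:=\mathrm{diam}(A)<\arccos\left(-\frac1{n+1}\right)$, then there must be $u\in\mathrm{conv}_{\mathbb{S}^n}(A)$ such that $A\subseteq\overline{B}_{\psi(D)}(u,\mathbb{S}^n)$, where $$\psi:\left[0,\arccos\left(-\tfrac1{n+1}\right)\right]\to\mathbb{R}_{\ge0},\qquad \psi(D)=\arccos\left(\sqrt{\frac{1+(n+1)\cos D}{n+2}}\right).$$
   Context: $\mathbb{S}^n\subset\mathbb{R}^{n+1}$ is the unit sphere with the geodesic (angular) distance $d_{\mathbb{S}^n}$; the diameter is with respect to $d_{\mathbb{S}^n}$, and $\overline{B}_\rho(u,\mathbb{S}^n)$ is the closed ball of radius $\rho$ around $u$ with respect to $d_{\mathbb{S}^n}$. For a nonempty subset $A\subset\mathbb{S}^n$, the geodesic convex hull $\mathrm{conv}_{\mathbb{S}^n}(A)$ is defined to be the set consisting of the union of all minimizing geodesics between pairs of points in $A$.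
   Formalization: The geodesic convex hull of A is taken as the smallest subset of the sphere containing A and closed under minimizing geodesics, not the one-step union of geodesics between points of A; with the latter the claim fails for the three standard basis vectors in S^2. *)

theory Defs
  imports "HOL-Analysis.Analysis"
begin

abbreviation unit_sphere :: "(real ^ 'm) set"
  where "unit_sphere \<equiv> sphere 0 1"

text \<open>The definitions below are only meaningful for points of the unit sphere.\<close>

definition sphere_dist :: "real ^ 'm \<Rightarrow> real ^ 'm \<Rightarrow> real"
  where "sphere_dist x y = arccos (x \<bullet> y)"

text \<open>The supremum is a genuine one for every nonempty subset of the sphere, because
  angular distances are at most \<open>pi\<close>.\<close>

definition sphere_diam :: "(real ^ 'm) set \<Rightarrow> real"
  where "sphere_diam A = (SUP (x, y) \<in> A \<times> A. sphere_dist x y)"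

definition sphere_cball :: "real \<Rightarrow> real ^ 'm \<Rightarrow> (real ^ 'm) set"
  where "sphere_cball r u = {x \<in> unit_sphere. sphere_dist u x \<le> r}"

text \<open>Minimizing geodesics are parametrized by arc length, so they are the isometric
  embeddings of the interval from 0 to the distance of the end points. Antipodal end points
  are joined by more than one of them (if the sphere has positive dimension), and all of them
  count.\<close>

definition minimizing_geodesic :: "(real \<Rightarrow> real ^ 'm) \<Rightarrow> real ^ 'm \<Rightarrow> real ^ 'm \<Rightarrow> bool"
  where "minimizing_geodesic g x y \<longleftrightarrow>
    g ` {0..sphere_dist x y} \<subseteq> unit_sphere \<and>
    g 0 = x \<and> g (sphere_dist x y) = y \<and>
    (\<forall>s\<in>{0..sphere_dist x y}. \<forall>t\<in>{0..sphere_dist x y}.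
      sphere_dist (g s) (g t) = \<bar>s - t\<bar>)"

definition geodesic_union :: "(real ^ 'm) set \<Rightarrow> (real ^ 'm) set"
  where "geodesic_union A =
    \<Union> {g ` {0..sphere_dist x y} |g x y. x \<in> A \<and> y \<in> A \<and> minimizing_geodesic g x y}"

definition geodesically_convex :: "(real ^ 'm) set \<Rightarrow> bool"
  where "geodesically_convex C \<longleftrightarrow> C \<subseteq> unit_sphere \<and> geodesic_union C \<subseteq> C"

text \<open>The geodesic convex hull is the closure of \<open>A\<close> under joining pairs of points by
  minimizing geodesics, i.e. the union of all iterates of \<^const>\<open>geodesic_union\<close> on \<open>A\<close>.
  A single application of \<^const>\<open>geodesic_union\<close> is not enough: it need
  not be convex, and it misses the interior of a spherical triangle. For the three standard
  basis vectors on the 2-sphere the diameter is \<open>pi / 2\<close>, and every point on one of the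
  joining arcs has distance \<open>pi / 2\<close> from the opposite vertex, whereas \<open>psi 2 (pi / 2) = pi / 3\<close>
  for the radius \<open>psi\<close> below.\<close>

definition sphere_conv :: "(real ^ 'm) set \<Rightarrow> (real ^ 'm) set"
  where "sphere_conv A = geodesically_convex hull A"

text \<open>Only relevant for \<open>0 \<le> D \<le> arccos (- 1 / (n + 1))\<close>, where the radicand lies between 0 and 1.\<close>

definition psi :: "nat \<Rightarrow> real \<Rightarrow> real"
  where "psi n D = arccos (sqrt ((1 + (real n + 1) * cos D) / (real n + 2)))"

end

theory Submission
  imports Defs
begin

text \<open>Let \<open>c = cos D\<close>, so that \<open>x \<bullet> y \<ge> c\<close> on the closure of \<open>A\<close>, and let \<open>p\<close> be the point of
  minimal norm in the Euclidean convex hull of this closure. Then \<open>p \<bullet> x \<ge> |p|^2\<close> for all \<open>x\<close> in \<open>A\<close>,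
  so the direction of \<open>p\<close> has distance at most \<open>arccos |p|\<close> from all of \<open>A\<close>. Expanding \<open>|p|^2\<close> for a
  convex combination of \<open>k\<close> points gives \<open>|p|^2 \<ge> c + (1 - c) / k\<close>. Caratheodory's theorem allows
  \<open>k = n + 2\<close>, which is exactly the radius claimed; this shows \<open>p \<noteq> 0\<close>, and then \<open>k = n + 1\<close> is
  possible as well. The resulting strict inequality (if \<open>c < 1\<close>) leaves room to replace \<open>p\<close> by a
  nearby point in the convex hull of \<open>A\<close> itself, and such points project radially into the
  geodesic convex hull because \<open>A\<close> lies in an open hemisphere.\<close>

text \<open>In the expansion of \<open>(norm p)\<^sup>2\<close> with weights \<open>l\<close>,
  diagonal inner products are 1 and all others at least \<open>c\<close>, so it is at least
  \<open>c + (1 - c) * s\<close>, where \<open>s\<close> is the sum of the squared weights. By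
  Cauchy-Schwarz, \<open>s\<close> is at least \<open>1 / card S\<close>.\<close>

lemma norm_convex_combination_ge:
  fixes S :: "'a::real_inner set"
  assumes "finite S" and S1: "S \<subseteq> sphere 0 1"
    and c: "\<And>x y. x \<in> S \<Longrightarrow> y \<in> S \<Longrightarrow> c \<le> x \<bullet> y" and "c \<le> 1"
    and S: "card S \<le> k" and p: "p \<in> convex hull S"
  shows "c + (1 - c) / real k \<le> (norm p)\<^sup>2"
proof -
  obtain l where l: "\<And>x. x \<in> S \<Longrightarrow> 0 \<le> l x" "sum l S = 1" and pl: "p = (\<Sum>x\<in>S. l x *\<^sub>R x)"
    using p convex_hull_finite[OF \<open>finite S\<close>] by auto
  have "1 \<le> (\<Sum>x\<in>S. (l x)\<^sup>2) * real (card S)"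
    using sum_squared_le_sum_of_squares[of l S] l(2) by (simp add: mult.commute)
  also have "\<dots> \<le> (\<Sum>x\<in>S. (l x)\<^sup>2) * real k"
    using S by (intro mult_left_mono sum_nonneg) auto
  finally have k: "1 \<le> (\<Sum>x\<in>S. (l x)\<^sup>2) * real k" .
  then have "k > 0" by (cases "k = 0") auto
  then have "1 / real k \<le> (\<Sum>x\<in>S. (l x)\<^sup>2)"
    using k by (simp add: field_simps)
  then have "c + (1 - c) * (1 / real k) \<le> c + (1 - c) * (\<Sum>x\<in>S. (l x)\<^sup>2)"
    using \<open>c \<le> 1\<close> by (intro add_left_mono mult_left_mono) auto
  \<comment> \<open>The lower bound becomes the quadratic form of the matrix with 1 on the diagonal
    and \<open>c\<close> elsewhere, so that it can be compared with the Gram matrix entry by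
    entry.\<close>
  also have "\<dots> = (\<Sum>x\<in>S. \<Sum>y\<in>S. l x * l y * (c + (if x = y then 1 - c else 0)))"
  proof -
    have "(\<Sum>x\<in>S. \<Sum>y\<in>S. l x * l y * c) = c"
      using l(2) by (simp flip: sum_distrib_left sum_distrib_right)
    moreover have "(\<Sum>x\<in>S. \<Sum>y\<in>S. l x * l y * (if x = y then 1 - c else 0))
        = (1 - c) * (\<Sum>x\<in>S. (l x)\<^sup>2)"
      using \<open>finite S\<close> by (simp add: if_distrib sum.delta sum_distrib_left power2_eq_square mult_ac cong: if_cong)
    ultimately show ?thesis by (simp add: distrib_left sum.distrib)
  qed
  also have "\<dots> \<le> (\<Sum>x\<in>S. \<Sum>y\<in>S. l x * l y * (x \<bullet> y))"
  proof (intro sum_mono mult_left_mono)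
    fix x y assume "x \<in> S" "y \<in> S"
    then show "c + (if x = y then 1 - c else 0) \<le> x \<bullet> y"
      using c S1 by (auto simp: dot_square_norm subset_iff)
  qed (use l in auto)
  also have "\<dots> = (norm p)\<^sup>2"
  proof -
    have "(norm p)\<^sup>2 = (\<Sum>x\<in>S. l x *\<^sub>R x) \<bullet> p"
      by (simp add: power2_norm_eq_inner flip: pl)
    also have "\<dots> = (\<Sum>x\<in>S. l x * (\<Sum>y\<in>S. l y * (x \<bullet> y)))"
      unfolding inner_sum_left by (simp add: pl inner_sum_right sum_distrib_left mult.left_commute)
    finally show ?thesis by (simp add: sum_distrib_left mult.assoc)
  qed
  finally show ?thesis by simp
qed

text \<open>Radial projection maps the segment from \<open>x\<close> to \<open>y\<close> into the
  minor arc between them. In the orthonormal frame \<open>x\<close>, \<open>w\<close> this arc is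
  \<open>cos s *\<^sub>R x + sin s *\<^sub>R w\<close>, and the projected point is found at
  \<open>s = arccos \<alpha>\<close>.\<close>

lemma minimizing_geodesic_through_combination:
  fixes x y :: "real ^ 'm"
  assumes x: "x \<in> unit_sphere" and y: "y \<in> unit_sphere" and "x \<noteq> y" "x \<noteq> - y"
    and a: "0 \<le> a" and b: "0 \<le> b" and z0: "a *\<^sub>R x + b *\<^sub>R y \<noteq> 0"
  shows "\<exists>g. minimizing_geodesic g x y \<and>
    sgn (a *\<^sub>R x + b *\<^sub>R y) \<in> g ` {0..sphere_dist x y}"
proof -
  define c where "c = x \<bullet> y"
  define d where "d = sphere_dist x y"
  have nx: "norm x = 1" and ny: "norm y = 1" using x y by auto
  then have xx: "x \<bullet> x = 1" and yy: "y \<bullet> y = 1" by (simp_all add: dot_square_norm)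
  have c1: "\<bar>c\<bar> \<le> 1"
    using Cauchy_Schwarz_ineq2[of x y] nx ny by (simp add: c_def)
  have "c \<noteq> 1" "c \<noteq> -1"
  proof -
    have "(x - y) \<bullet> (x - y) \<noteq> 0" "(x + y) \<bullet> (x + y) \<noteq> 0"
      using \<open>x \<noteq> y\<close> \<open>x \<noteq> - y\<close> by (auto simp: add_eq_0_iff)
    then show "c \<noteq> 1" "c \<noteq> -1"
      using xx yy by (auto simp: c_def algebra_simps inner_commute)
  qed
  with c1 have c: "-1 < c" "c < 1" by auto
  have cosd: "cos d = c" and d: "0 < d" "d < pi"
    using c arccos_lt_bounded[of c] by (auto simp: d_def sphere_dist_def c_def)
  have sind: "0 < sin d" using d sin_gt_zero by blast
  \<comment> \<open>The unit tangent vector at \<open>x\<close> pointing towards \<open>y\<close>,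
    by Gram-Schmidt; \<open>sin d > 0\<close> because \<open>x\<close> and \<open>y\<close> are
    neither equal nor antipodal.\<close>
  define w where "w = (1 / sin d) *\<^sub>R (y - c *\<^sub>R x)"
  have yw: "y = cos d *\<^sub>R x + sin d *\<^sub>R w"
    using sind by (simp add: w_def cosd)
  have xw: "x \<bullet> w = 0"
    by (simp add: w_def inner_diff_right xx c_def)
  have ww: "w \<bullet> w = 1"
  proof -
    have "(cos d *\<^sub>R x + sin d *\<^sub>R w) \<bullet> (cos d *\<^sub>R x + sin d *\<^sub>R w) = 1"
      using yy by (simp flip: yw)
    then have "(sin d)\<^sup>2 * (w \<bullet> w) + (cos d)\<^sup>2 = 1"
      by (simp add: inner_add_left inner_add_right inner_commute[of w x] xw xx power2_eq_square)
    then have "(sin d)\<^sup>2 * (w \<bullet> w) = (sin d)\<^sup>2 * 1"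
      using sin_cos_squared_add[of d] by linarith
    then show ?thesis using sind by simp
  qed
  define g where "g = (\<lambda>s. cos s *\<^sub>R x + sin s *\<^sub>R w)"
  have gg: "g s \<bullet> g t = cos (s - t)" for s t
    using xx xw ww by (simp add: g_def inner_add_left inner_add_right cos_diff inner_commute)
  have geo: "minimizing_geodesic g x y"
    unfolding minimizing_geodesic_def d_def[symmetric]
  proof (intro conjI ballI)
    show "g ` {0..d} \<subseteq> unit_sphere" by (auto simp: norm_eq_1 gg)
    show "g 0 = x" "g d = y" using yw by (auto simp: g_def)
    fix s t assume "s \<in> {0..d}" "t \<in> {0..d}"
    then have "0 \<le> \<bar>s - t\<bar>" "\<bar>s - t\<bar> \<le> pi" using d by auto
    then have "arccos (cos \<bar>s - t\<bar>) = \<bar>s - t\<bar>" by (rule arccos_cos)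
    then show "sphere_dist (g s) (g t) = \<bar>s - t\<bar>" by (simp add: sphere_dist_def gg)
  qed
  define m where "m = norm (a *\<^sub>R x + b *\<^sub>R y)"
  have m: "m > 0" using z0 by (simp add: m_def)
  define \<alpha> where "\<alpha> = (a + b * c) / m"
  define \<beta> where "\<beta> = b * sin d / m"
  have z: "sgn (a *\<^sub>R x + b *\<^sub>R y) = \<alpha> *\<^sub>R x + \<beta> *\<^sub>R w"
  proof -
    have "a *\<^sub>R x + b *\<^sub>R y = (a + b * c) *\<^sub>R x + (b * sin d) *\<^sub>R w"
      by (subst yw) (simp add: cosd algebra_simps)
    then show ?thesis
      unfolding sgn_div_norm m_def[symmetric]
      by (simp add: \<alpha>_def \<beta>_def scaleR_right_distrib divide_inverse_commute)
  qed
  have "norm (\<alpha> *\<^sub>R x + \<beta> *\<^sub>R w) = 1"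
    using z0 by (simp flip: z add: norm_sgn)
  then have ab: "\<alpha>\<^sup>2 + \<beta>\<^sup>2 = 1"
    using xx xw ww by (simp add: norm_eq_1 inner_add_left inner_add_right inner_commute power2_eq_square)
  have \<beta>: "\<beta> \<ge> 0" using b sind m by (simp add: \<beta>_def)
  have "\<alpha>\<^sup>2 \<le> 1" using ab by (smt (verit) zero_le_power2)
  then have \<alpha>: "-1 \<le> \<alpha>" "\<alpha> \<le> 1" by (auto simp: abs_square_le_1 abs_le_iff)
  \<comment> \<open>This is \<open>c \<le> \<alpha>\<close>, which keeps the parameter
    \<open>arccos \<alpha>\<close> from overshooting \<open>d\<close>. The sign of \<open>c\<close>
    decides whether \<open>m\<close> has to be bounded from above or from below.\<close>
  have "c * m \<le> a + b * c"
  proof (cases "c \<ge> 0")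
    case True
    have "m \<le> a + b" unfolding m_def using norm_triangle_ineq[of "a *\<^sub>R x" "b *\<^sub>R y"] nx ny a b by simp
    then have "c * m \<le> c * (a + b)" using True by (intro mult_left_mono) auto
    also have "\<dots> \<le> a + b * c" using a c mult_left_le_one_le[of a c] True by (simp add: algebra_simps)
    finally show ?thesis .
  next
    case False
    have "b - a \<le> m"
      using norm_diff_ineq[of "b *\<^sub>R y" "a *\<^sub>R x"] nx ny a b by (simp add: m_def add.commute)
    then have "c * m \<le> c * (b - a)" using False by (intro mult_left_mono_neg) auto
    also have "\<dots> \<le> a + b * c"
      using mult_left_mono[of "-c" 1 a] a c by (simp add: algebra_simps)
    finally show ?thesis .
  qed
  then have "c \<le> \<alpha>" using m by (simp add: \<alpha>_def field_simps)
  then have "arccos \<alpha> \<le> d"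
    using \<alpha> c by (auto simp: d_def sphere_dist_def simp flip: c_def intro: arccos_le_arccos)
  \<comment> \<open>Since \<open>\<beta> \<ge> 0\<close>, the point lies on the half of the great
    circle that starts at \<open>x\<close> in the direction \<open>w\<close>.\<close>
  moreover have "sin (arccos \<alpha>) = \<beta>"
    using ab \<alpha> \<beta> by (simp add: sin_arccos real_sqrt_unique flip: ab)
  then have "g (arccos \<alpha>) = sgn (a *\<^sub>R x + b *\<^sub>R y)"
    using \<alpha> by (simp add: g_def z)
  ultimately show ?thesis
    using geo \<alpha> arccos_lbound[of \<alpha>] by (force simp: d_def[symmetric])
qed

text \<open>For every geodesically convex \<open>C\<close> containing \<open>A\<close>, the part of
  the cone over \<open>C\<close> in the open half-space of \<open>p\<close> is convex and contains
  \<open>A\<close>, hence contains the convex hull of \<open>A\<close>. The half-space excludes 0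
  and antipodal directions, where radial projection of segments breaks down.\<close>

lemma sgn_convex_hull_in_sphere_conv:
  fixes A :: "(real ^ 'm) set"
  assumes A: "A \<subseteq> unit_sphere" and h: "\<And>x. x \<in> A \<Longrightarrow> 0 < p \<bullet> x"
    and q: "q \<in> convex hull A"
  shows "sgn q \<in> sphere_conv A"
  unfolding sphere_conv_def hull_def
proof (rule InterI, clarify)
  fix C :: "(real ^ 'm) set" assume C: "geodesically_convex C" "A \<subseteq> C"
  define T where "T = {z. 0 < p \<bullet> z \<and> sgn z \<in> C}"
  have "convex T"
  proof (rule convexI)
    fix x y and u v :: real assume xy: "x \<in> T" "y \<in> T" and uv: "0 \<le> u" "0 \<le> v" "u + v = 1"
    let ?z = "u *\<^sub>R x + v *\<^sub>R y"
    have px: "0 < p \<bullet> x" "0 < p \<bullet> y" and sC: "sgn x \<in> C" "sgn y \<in> C" using xy by (auto simp: T_def)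
    then have [simp]: "x \<noteq> 0" "y \<noteq> 0" by auto
    have pz: "0 < p \<bullet> ?z"
      using px uv by (cases "u = 0") (auto simp: inner_add_right intro!: add_pos_nonneg)
    have z: "?z = (u * norm x) *\<^sub>R sgn x + (v * norm y) *\<^sub>R sgn y"
      by (simp add: sgn_div_norm mult.assoc)
    have "sgn ?z \<in> C"
    \<comment> \<open>The arc lemma needs distinct end points; if the directions agree,
      \<open>?z\<close> is a positive multiple of the common one.\<close>
    proof (cases "sgn x = sgn y")
      case True
      have "sgn (sgn y) = sgn y"
        by (simp add: sgn_div_norm[of "sgn y"] norm_sgn)
      moreover have "u * norm x + v * norm y > 0"
        using uv by (cases "u = 0") (auto intro!: add_pos_nonneg)
      ultimately show ?thesis
        unfolding z True using sC by (simp add: sgn_scaleR flip: scaleR_left_distrib)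
    next
      case False
      have "0 < p \<bullet> sgn x" "0 < p \<bullet> sgn y" using px by (auto simp: sgn_div_norm)
      then have ne: "sgn x \<noteq> - sgn y" by (metis inner_minus_right neg_0_less_iff_less order_less_asym)
      have nz: "(u * norm x) *\<^sub>R sgn x + (v * norm y) *\<^sub>R sgn y \<noteq> 0"
        using pz unfolding z[symmetric] by (metis inner_zero_right less_irrefl)
      obtain g where g: "minimizing_geodesic g (sgn x) (sgn y)"
        "sgn ?z \<in> g ` {0..sphere_dist (sgn x) (sgn y)}"
        using minimizing_geodesic_through_combination[of "sgn x" "sgn y" "u * norm x" "v * norm y"] False ne nz uv
        unfolding z by (auto simp: norm_sgn)
      then have "sgn ?z \<in> geodesic_union C"
        unfolding geodesic_union_def using sC by blast
      then show ?thesis using C unfolding geodesically_convex_def by blast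
    qed
    with pz show "?z \<in> T" by (simp add: T_def)
  qed
  moreover have "A \<subseteq> T"
    using A C(2) h by (auto simp: T_def sgn_div_norm subset_iff)
  ultimately have "convex hull A \<subseteq> T" by (simp add: hull_minimal)
  then show "sgn q \<in> C" using q by (auto simp: T_def)
qed

text \<open>The minimal-norm point \<open>p\<close> lies on the supporting hyperplane orthogonal to \<open>p\<close>, which
  saves one point in Caratheodory's theorem.\<close>

lemma min_norm_point_convex_hull:
  fixes S :: "'a::euclidean_space set"
  assumes "compact S" and "S \<noteq> {}" and S1: "S \<subseteq> sphere 0 1"
    and c: "\<And>x y. x \<in> S \<Longrightarrow> y \<in> S \<Longrightarrow> c \<le> x \<bullet> y" and "c \<le> 1"
    and pos: "0 < 1 + real DIM('a) * c"
  obtains p where "p \<in> convex hull S" "\<And>x. x \<in> S \<Longrightarrow> (norm p)\<^sup>2 \<le> p \<bullet> x"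
    "p \<noteq> 0" "c + (1 - c) / real DIM('a) \<le> (norm p)\<^sup>2"
proof -
  let ?K = "convex hull S"
  define p where "p = closest_point ?K 0"
  have K: "compact ?K" "?K \<noteq> {}" using assms by (auto intro: compact_convex_hull)
  have pK: "p \<in> ?K" unfolding p_def using K by (intro closest_point_in_set compact_imp_closed)
  \<comment> \<open>The variational inequality for the projection of 0 onto
    \<open>?K\<close>.\<close>
  have px: "(norm p)\<^sup>2 \<le> p \<bullet> x" if "x \<in> ?K" for x
    using closest_point_dot[of ?K x 0] that K
    by (simp add: p_def[symmetric] compact_imp_closed inner_diff_right dot_square_norm)
  \<comment> \<open>This has to come first: only for \<open>p \<noteq> 0\<close> does
    \<open>p \<bullet> x = (norm p)\<^sup>2\<close> describe a hyperplane. With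
    \<open>DIM('a) + 1\<close> points the norm bound is positive exactly by
    \<open>pos\<close>.\<close>
  have p0: "p \<noteq> 0"
  proof -
    obtain T where T: "finite T" "T \<subseteq> S" "card T \<le> DIM('a) + 1" "p \<in> convex hull T"
      using pK unfolding caratheodory[of S] by auto
    have "c + (1 - c) / real (DIM('a) + 1) \<le> (norm p)\<^sup>2"
    proof (rule norm_convex_combination_ge[of T])
      show "T \<subseteq> sphere 0 1" using T(2) S1 by blast
      show "c \<le> x \<bullet> y" if "x \<in> T" "y \<in> T" for x y using that T(2) c by blast
    qed (use T \<open>c \<le> 1\<close> in simp_all)
    moreover have "0 < c + (1 - c) / real (DIM('a) + 1)"
      using pos by (simp add: field_simps)
    ultimately show ?thesis by auto
  qed
  \<comment> \<open>The supporting hyperplane cuts out a face containing \<open>p\<close>. As a face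
    of the hull of a compact set it is the hull of some \<open>S' \<subseteq> S\<close>, so
    Caratheodory still yields unit vectors from \<open>S\<close>, now inside a set of affine
    dimension at most \<open>DIM('a) - 1\<close>.\<close>
  have face: "?K \<inter> {x. p \<bullet> x = (norm p)\<^sup>2} face_of ?K"
    using px by (intro face_of_Int_supporting_hyperplane_ge) auto
  obtain S' where S': "S' \<subseteq> S" "?K \<inter> {x. p \<bullet> x = (norm p)\<^sup>2} = convex hull S'"
    using face_of_convex_hull_subset[OF \<open>compact S\<close> face] .
  have pS': "p \<in> convex hull S'"
    unfolding S'(2)[symmetric] using pK by (simp add: dot_square_norm)
  have "S' \<subseteq> {x. p \<bullet> x = (norm p)\<^sup>2}" using hull_subset[of S' convex] unfolding S'(2)[symmetric] by simp
  from aff_dim_subset[OF this] have dim: "aff_dim S' \<le> int DIM('a) - 1"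
    using p0 DIM_positive[where 'a='a] by (simp add: of_nat_diff)
  obtain T where T: "finite T" "T \<subseteq> S'" "card T \<le> aff_dim S' + 1" "p \<in> convex hull T"
    using caratheodory_aff_dim[THEN equalityD1, THEN subsetD, OF pS'] by (elim CollectE exE conjE) rule
  have "c + (1 - c) / real DIM('a) \<le> (norm p)\<^sup>2"
  proof (rule norm_convex_combination_ge[of T])
    show "T \<subseteq> sphere 0 1" using T(2) S'(1) S1 by blast
    show "c \<le> x \<bullet> y" if "x \<in> T" "y \<in> T" for x y using that T(2) S'(1) c by blast
    show "card T \<le> DIM('a)" using T(3) dim by simp
  qed (use T \<open>c \<le> 1\<close> in auto)
  with pK p0 show ?thesis
    by (intro that[of p]) (simp_all add: px hull_inc)
qed

theorem theorem13:
  fixes n :: nat and A :: "(real ^ 'm) set"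
  assumes "n \<ge> 1" and "CARD('m) = n + 1"
    and "A \<subseteq> unit_sphere" and "A \<noteq> {}"
    and "sphere_diam A < arccos (- 1 / (real n + 1))"
  shows "\<exists>u \<in> sphere_conv A. A \<subseteq> sphere_cball (psi n (sphere_diam A)) u"
proof -
  define D where "D = sphere_diam A"
  define c where "c = cos D"
  \<comment> \<open>The squared cosine of the claimed radius.\<close>
  define r where "r = (1 + (real n + 1) * c) / (real n + 2)"
  have dot: "\<bar>x \<bullet> y\<bar> \<le> 1" if "x \<in> unit_sphere" "y \<in> unit_sphere" for x y :: "real ^ 'm"
    using Cauchy_Schwarz_ineq2[of x y] that by simp
  then have dotA: "-1 \<le> x \<bullet> y" "x \<bullet> y \<le> 1" if "x \<in> A" "y \<in> A" for x y
    using that \<open>A \<subseteq> unit_sphere\<close> by (force simp: abs_le_iff)+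
  have bdd: "bdd_above ((\<lambda>(x, y). sphere_dist x y) ` (A \<times> A))"
    using dotA by (intro bdd_aboveI[of _ pi]) (auto simp: sphere_dist_def intro!: arccos_ubound)
  have le_D: "arccos (x \<bullet> y) \<le> D" if "x \<in> A" "y \<in> A" for x y
    using cSUP_upper[OF _ bdd, of "(x, y)"] that
    by (simp add: D_def sphere_diam_def sphere_dist_def)
  have n1: "-1 \<le> - 1 / (real n + 1)" "- 1 / (real n + 1) \<le> 1" by (auto simp: field_simps)
  have "0 \<le> D"
    using \<open>A \<noteq> {}\<close> le_D dotA arccos_lbound by (meson ex_in_conv order_trans)
  have "D \<le> pi" using assms(5) arccos_ubound[OF n1] by (simp add: D_def)
  have cA: "c \<le> x \<bullet> y" if "x \<in> A" "y \<in> A" for x y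
    unfolding c_def
    using cos_monotone_0_pi_le[of "arccos (x \<bullet> y)" D] le_D[OF that] dotA[OF that] \<open>D \<le> pi\<close>
    by (simp add: arccos_lbound)
  have "c \<le> 1" by (simp add: c_def)
  have "- 1 / (real n + 1) < c"
    using cos_monotone_0_pi[of D "arccos (- 1 / (real n + 1))"] \<open>0 \<le> D\<close> assms(5) n1 arccos_ubound[OF n1]
    by (simp add: c_def D_def)
  \<comment> \<open>As the ambient dimension is \<open>n + 1\<close>, the bound on the diameter
    turns into the positivity assumption of \<open>min_norm_point_convex_hull\<close>.\<close>
  then have pos: "0 < 1 + (real n + 1) * c" by (simp add: field_simps)
  then have "0 < r" by (simp add: r_def)
  have reduce: ?thesis if u: "u \<in> sphere_conv A" "u \<in> unit_sphere" "\<And>x. x \<in> A \<Longrightarrow> sqrt r \<le> u \<bullet> x" for u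
  proof (intro bexI[of _ u] subsetI u)
    fix x assume x: "x \<in> A"
    then have "u \<bullet> x \<le> 1" using dot[OF u(2)] \<open>A \<subseteq> unit_sphere\<close> by (force simp: abs_le_iff)
    moreover have "-1 \<le> sqrt r" using \<open>0 < r\<close> by (smt (verit) real_sqrt_gt_zero)
    ultimately have "arccos (u \<bullet> x) \<le> arccos (sqrt r)"
      using u(3)[OF x] by (intro arccos_le_arccos) auto
    then show "x \<in> sphere_cball (psi n (sphere_diam A)) u"
      using x \<open>A \<subseteq> unit_sphere\<close>
      by (auto simp: sphere_cball_def sphere_dist_def psi_def r_def c_def D_def)
  qed
  show ?thesis
  proof (cases "c = 1")
    \<comment> \<open>All inner products within \<open>A\<close> are 1, so \<open>A\<close> is a
      single point and serves as its own centre; the strict inequality used in the other case fails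
      here.\<close>
    case True
    obtain a where a: "a \<in> A" using \<open>A \<noteq> {}\<close> by blast
    have "a \<in> sphere_conv A" using a by (simp add: sphere_conv_def hull_inc)
    moreover have "r = 1" using True by (simp add: r_def)
    ultimately show ?thesis
      using reduce[of a] cA[OF a] a \<open>A \<subseteq> unit_sphere\<close> True by auto
  next
    case False
    let ?S = "closure A"
    have S1: "?S \<subseteq> unit_sphere" using \<open>A \<subseteq> unit_sphere\<close> by (simp add: closure_minimal)
    then have "compact ?S" by (meson bounded_sphere bounded_subset closed_closure compact_eq_bounded_closed)
    \<comment> \<open>The bound is a closed condition on pairs, so it passes to the closure of
      \<open>A \<times> A\<close>, which is the product of the closures.\<close>
    have cS: "c \<le> x \<bullet> y" if "x \<in> ?S" "y \<in> ?S" for x y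
    proof -
      have "closure (A \<times> A) \<subseteq> {z. c \<le> fst z \<bullet> snd z}"
        using cA by (intro closure_minimal closed_Collect_le continuous_intros) auto
      then show ?thesis using that by (auto simp: closure_Times)
    qed
    have "?S \<noteq> {}" using \<open>A \<noteq> {}\<close> by simp
    have dim: "real DIM(real ^ 'm) = real n + 1" using assms(2) by simp
    obtain p where p: "p \<in> convex hull ?S" "\<And>x. x \<in> ?S \<Longrightarrow> (norm p)\<^sup>2 \<le> p \<bullet> x" "p \<noteq> 0"
      and pc: "c + (1 - c) / (real n + 1) \<le> (norm p)\<^sup>2"
      using min_norm_point_convex_hull[OF \<open>compact ?S\<close> \<open>?S \<noteq> {}\<close> S1 cS \<open>c \<le> 1\<close>] pos
      unfolding dim by metis
    have "r = c + (1 - c) / (real n + 2)" by (simp add: r_def field_simps)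
    also have "\<dots> < c + (1 - c) / (real n + 1)"
      using False \<open>c \<le> 1\<close> by (intro add_strict_left_mono divide_strict_left_mono) auto
    also note pc
    finally have r: "sqrt r < norm p" by (simp add: real_less_lsqrt)
    \<comment> \<open>The solution of \<open>(norm p)\<^sup>2 - e = sqrt r * (norm p + e)\<close>:
      moving \<open>p\<close> by less than \<open>e\<close> lowers \<open>q \<bullet> x\<close> and
      raises \<open>norm q\<close> by less than \<open>e\<close> each, and this equation absorbs
      both errors.\<close>
    define e where "e = norm p * (norm p - sqrt r) / (1 + sqrt r)"
    have "e > 0" using r p(3) \<open>0 < r\<close> by (simp add: e_def add_pos_pos)
    have "p \<in> closure (convex hull A)"
      using p(1) hull_minimal[of ?S "closure (convex hull A)" convex]
      by (meson closure_mono convex_closure convex_convex_hull hull_subset subsetD)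
    then obtain q where q: "q \<in> convex hull A" "norm (q - p) < e"
      using \<open>e > 0\<close> by (auto simp: closure_approachable dist_norm)
    \<comment> \<open>\<open>A\<close> lies in the open hemisphere around the direction of
      \<open>p\<close>; this gives both \<open>q \<noteq> 0\<close> and the hypothesis of the radial
      projection lemma.\<close>
    have pA: "0 < p \<bullet> x" if "x \<in> A" for x
      using p(2)[of x] p(3) that closure_subset[of A] by (smt (verit) subsetD zero_less_norm_iff zero_less_power)
    have "convex hull A \<subseteq> {x. 0 < p \<bullet> x}"
      using pA by (intro hull_minimal convex_halfspace_gt) auto
    then have "q \<noteq> 0" using q(1) by auto
    have "sqrt r \<le> sgn q \<bullet> x" if x: "x \<in> A" for x
    proof -
      have "\<bar>(q - p) \<bullet> x\<bar> \<le> norm (q - p)"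
        using Cauchy_Schwarz_ineq2[of "q - p" x] x \<open>A \<subseteq> unit_sphere\<close> by (auto simp: subset_iff)
      then have qx: "(norm p)\<^sup>2 - norm (q - p) \<le> q \<bullet> x"
        using p(2)[of x] x closure_subset[of A] by (auto simp: inner_diff_left)
      have "sqrt r * norm q \<le> sqrt r * (norm p + norm (q - p))"
        using norm_triangle_sub[of q p] \<open>0 < r\<close> by (intro mult_left_mono) auto
      also have "\<dots> \<le> (norm p)\<^sup>2 - norm (q - p)"
      proof -
        have "norm (q - p) * (1 + sqrt r) \<le> e * (1 + sqrt r)"
          using q(2) \<open>0 < r\<close> by (intro mult_right_mono) auto
        also have "\<dots> = norm p * (norm p - sqrt r)"
          using \<open>0 < r\<close> by (simp add: e_def add_pos_pos less_imp_neq[symmetric])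
        finally show ?thesis by (simp add: algebra_simps power2_eq_square)
      qed
      also note qx
      finally show ?thesis
        using \<open>q \<noteq> 0\<close> by (simp add: sgn_div_norm field_simps)
    qed
    moreover have "sgn q \<in> sphere_conv A"
      using sgn_convex_hull_in_sphere_conv[OF \<open>A \<subseteq> unit_sphere\<close> pA q(1)] .
    ultimately show ?thesis
      using reduce[of "sgn q"] \<open>q \<noteq> 0\<close> by (simp add: norm_sgn)
  qed
qed

end
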